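(* Let $\mathbb{F}$ be $\mathbb{R}$ or $\mathbb{C}$, let $H$ be any Hilbert space over $\mathbb{F}$ (finite or infinite-dimensional), and let $n\ge 1$ be an integer with $\dim H \geq n$. Then there is a homeomorphism \[ \Phi: \operatorname{St}(n,H) \xrightarrow{\;\cong\;} \operatorname{St}_{\operatorname{orth}}(n,H) \times \operatorname{P}_n(\mathbb{F}). \]
   Context: $\operatorname{St}(n,H) = \{(v_1,\ldots,v_n)\in H^n : v_1,\ldots,v_n \text{ are linearly independent}\}$ and $\operatorname{St}_{\operatorname{orth}}(n,H) = \{(v_1,\ldots,v_n)\in H^n : \langle v_i,v_j\rangle = \delta_{ij} \text{ for all } i,j\}$, both with the subspace topology from the norm topology on $H^n$. $\operatorname{P}_n(\mathbb{F})$ is the set of positive definite self-adjoint $n\times n$ matrices with entries in $\mathbb{F}$, with the subspace topology from the space of $n\times n$ matrices. The product carries the product topology. *)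

theory Defs
  imports "HOL-Analysis.Analysis"
begin

text \<open>
  Complex inner product spaces; the inner product is conjugate-linear in its first argument.
  Extending class \<open>real_normed_vector\<close> makes the norm induced by the inner product
  carry the metric and the topology of the type. Its norm axioms follow from the inner product
  axioms, so this is no restriction.
\<close>

class complex_inner = real_normed_vector +
  fixes scaleC :: "complex \<Rightarrow> 'a \<Rightarrow> 'a"  (infixr "*\<^sub>C" 75)
    and cinner :: "'a \<Rightarrow> 'a \<Rightarrow> complex"
  assumes scaleC_add_right: "c *\<^sub>C (x + y) = c *\<^sub>C x + c *\<^sub>C y"
    and scaleC_add_left: "(c + d) *\<^sub>C x = c *\<^sub>C x + d *\<^sub>C x"
    and scaleC_scaleC: "c *\<^sub>C (d *\<^sub>C x) = (c * d) *\<^sub>C x"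
    and scaleC_one: "1 *\<^sub>C x = x"
    and scaleR_scaleC: "r *\<^sub>R x = complex_of_real r *\<^sub>C x"
    and cinner_commute: "cinner x y = cnj (cinner y x)"
    and cinner_add_left: "cinner (x + y) z = cinner x z + cinner y z"
    and cinner_scaleC_left: "cinner (c *\<^sub>C x) y = cnj c * cinner x y"
    and cinner_ge_zero: "0 \<le> Re (cinner x x)"
    and cinner_eq_zero_iff: "cinner x x = 0 \<longleftrightarrow> x = 0"
    and norm_eq_sqrt_cinner: "norm x = sqrt (Re (cinner x x))"

class complex_hilbert = complex_inner + complete_space

global_interpretation complex_vector: vector_space "scaleC :: complex \<Rightarrow> 'a \<Rightarrow> 'a::complex_inner"
  by standard (simp_all add: scaleC_add_right scaleC_add_left scaleC_scaleC scaleC_one)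

instantiation complex :: complex_hilbert
begin

definition scaleC_complex :: "complex \<Rightarrow> complex \<Rightarrow> complex" where
  "scaleC_complex c x = c * x"

definition cinner_complex :: "complex \<Rightarrow> complex \<Rightarrow> complex" where
  "cinner_complex x y = cnj x * y"

instance
proof
  fix x :: complex
  show "cinner x x = 0 \<longleftrightarrow> x = 0"
    by (simp add: cinner_complex_def)
  show "norm x = sqrt (Re (cinner x x))"
    by (simp add: cinner_complex_def cmod_def flip: power2_eq_square)
qed (simp_all add: scaleC_complex_def cinner_complex_def scaleR_conv_of_real ring_distribs
    mult.commute mult.left_commute)

end

text \<open>
  In the next three definitions the scalar multiplication \<open>smul\<close> and the inner product \<open>ip\<close>
  are parameters, so that they apply to real and to complex spaces. The dimension is the
  cardinality of a Hamel basis; whether it is at least a given natural number does not change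
  if orthonormal bases are used instead.
\<close>

definition dim_at_least :: "('f::field \<Rightarrow> 'h::ab_group_add \<Rightarrow> 'h) \<Rightarrow> nat \<Rightarrow> bool" where
  "dim_at_least smul n \<longleftrightarrow>
    (\<exists>B. \<not> module.dependent smul B \<and> module.span smul B = UNIV \<and> (infinite B \<or> n \<le> card B))"

text \<open>
  Linear independence of a tuple: its entries are distinct and form an independent set.
\<close>

definition stiefel :: "('f::field \<Rightarrow> 'h::ab_group_add \<Rightarrow> 'h) \<Rightarrow> ('h ^ 'n) set" where
  "stiefel smul = {v. inj (($) v) \<and> \<not> module.dependent smul (range (($) v))}"

definition orth_stiefel :: "('h \<Rightarrow> 'h \<Rightarrow> 'f::field) \<Rightarrow> ('h ^ 'n) set" where
  "orth_stiefel ip = {v. \<forall>i j. ip (v $ i) (v $ j) = (if i = j then 1 else 0)}"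

definition pos_def_real :: "(real ^ 'n ^ 'n) set" where
  "pos_def_real = {A. transpose A = A \<and> (\<forall>x. x \<noteq> 0 \<longrightarrow> 0 < x \<bullet> (A *v x))}"

definition conj_transpose :: "complex ^ 'n ^ 'm \<Rightarrow> complex ^ 'm ^ 'n" where
  "conj_transpose A = (\<chi> i j. cnj (A $ j $ i))"

text \<open>
  The quadratic form of a self-adjoint matrix takes real values, so only the sign of its real
  part has to be prescribed.
\<close>

definition pos_def_complex :: "(complex ^ 'n ^ 'n) set" where
  "pos_def_complex = {A. conj_transpose A = A \<and>
     (\<forall>x. x \<noteq> 0 \<longrightarrow> 0 < Re (\<Sum>i\<in>UNIV. cnj (x $ i) * (A *v x) $ i))}"

end

theory Submission
  imports Defs
begin

text \<open>
  Gram-Schmidt orthonormalisation of the standard basis of \<open>F\<^sup>n\<close> with respect to the inner product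
  \<open>(x, y) \<mapsto> x\<^sup>* P y\<close> gives a matrix \<open>T(P)\<close> that depends continuously on the positive definite
  matrix \<open>P\<close> and satisfies \<open>T(P)\<^sup>* P T(P) = 1\<close>, whence \<open>T(P)\<inverse> = T(P)\<^sup>* P\<close>. Writing a frame
  \<open>v\<close> as a row on which matrices act from the right, and \<open>G(v)\<close> for its Gram matrix, one has
  \<open>G(v A) = A\<^sup>* G(v) A\<close>. So \<open>v \<mapsto> (v T(G(v)), G(v))\<close> and \<open>(u, P) \<mapsto> u T(P)\<^sup>* P\<close> are continuous
  and inverse to each other. The polar decomposition, which would take \<open>P\<^sup>-\<^sup>1\<^sup>/\<^sup>2\<close> for \<open>T(P)\<close>,
  is thereby avoided, and with it the functional calculus.
\<close>

section \<open>Scalars with a conjugation, covering both fields\<close>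

text \<open>For the reals both maps are the identity; for the complex numbers they are
  \<open>cnj\<close> and \<open>Re\<close>. \<open>self_conj_real\<close> is what permits
  normalising by a real square root.\<close>

locale involutive_scalars =
  fixes cj :: "'f::real_normed_field \<Rightarrow> 'f"
    and rpart :: "'f \<Rightarrow> real"
  assumes cj_add: "cj (a + b) = cj a + cj b"
    and cj_mult: "cj (a * b) = cj a * cj b"
    and cj_cj: "cj (cj a) = a"
    and cj_of_real: "cj (of_real r) = of_real r"
    and self_conj_real: "cj a = a \<Longrightarrow> of_real (rpart a) = a"
    and continuous_cj: "continuous_on UNIV cj"
    and continuous_rpart: "continuous_on UNIV rpart"
begin

lemma cj_0: "cj 0 = 0"
  using cj_of_real[of 0] by simp

lemma cj_sum: "cj (sum f A) = (\<Sum>a\<in>A. cj (f a))"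
  by (induction A rule: infinite_finite_induct) (simp_all add: cj_0 cj_add)

lemma continuous_on_cj [continuous_intros]:
  "continuous_on S f \<Longrightarrow> continuous_on S (\<lambda>x. cj (f x))"
  using continuous_on_compose2[OF continuous_cj] by blast

lemma continuous_on_rpart [continuous_intros]:
  "continuous_on S f \<Longrightarrow> continuous_on S (\<lambda>x. rpart (f x))"
  using continuous_on_compose2[OF continuous_rpart] by blast

section \<open>Adjoints and the sesquilinear form of a matrix\<close>

definition adj :: "'f ^ 'n ^ 'm \<Rightarrow> 'f ^ 'm ^ 'n" where
  "adj A = (\<chi> i j. cj (A $ j $ i))"

lemma adj_adj: "adj (adj A) = A"
  by (simp add: adj_def cj_cj vec_eq_iff)

lemma adj_mult: "adj (A ** B) = adj B ** adj A"
  by (simp add: adj_def matrix_matrix_mult_def vec_eq_iff cj_sum cj_mult mult.commute)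

lemma continuous_on_adj [continuous_intros]:
  "continuous_on S f \<Longrightarrow> continuous_on S (\<lambda>x. adj (f x))"
  unfolding adj_def by (intro continuous_intros)

lemma continuous_on_matrix_mult [continuous_intros]:
  fixes f :: "_ \<Rightarrow> 'f ^ 'n ^ 'm" and g :: "_ \<Rightarrow> 'f ^ 'l ^ 'n"
  shows "continuous_on S f \<Longrightarrow> continuous_on S g \<Longrightarrow> continuous_on S (\<lambda>x. f x ** g x)"
  unfolding matrix_matrix_mult_def by (intro continuous_intros)

definition form :: "'f ^ 'n ^ 'n \<Rightarrow> 'f ^ 'n \<Rightarrow> 'f ^ 'n \<Rightarrow> 'f" where
  "form P x y = (\<Sum>i\<in>UNIV. \<Sum>j\<in>UNIV. cj (x $ i) * P $ i $ j * y $ j)"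

definition pos_def :: "('f ^ 'n ^ 'n) set" where
  "pos_def = {P. adj P = P \<and> (\<forall>x. x \<noteq> 0 \<longrightarrow> 0 < rpart (form P x x))}"

lemma form_conv_matrix_vector_mult:
  "form P x y = (\<Sum>i\<in>UNIV. cj (x $ i) * (P *v y) $ i)"
  by (simp add: form_def matrix_vector_mult_def sum_distrib_left mult.assoc)

text \<open>Lets \<open>adj T ** P ** T = mat 1\<close> be read as orthonormality of the columns of
  \<open>T\<close> for \<open>form P\<close>.\<close>

lemma form_columns:
  "(adj A ** P ** A) $ i $ j = form P (column i A) (column j A)"
  unfolding form_def matrix_matrix_mult_def adj_def column_def
  by (simp add: sum_distrib_right) (rule sum.swap)

lemma form_diff_right: "form P x (y - z) = form P x y - form P x z"
  by (simp add: form_def right_diff_distrib sum_subtractf)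

lemma form_scale_right: "form P x (c *s y) = c * form P x y"
  by (simp add: form_def sum_distrib_left mult_ac)

lemma form_scale_left: "form P (c *s x) y = cj c * form P x y"
  by (simp add: form_def sum_distrib_left mult_ac cj_mult)

lemma form_0_right: "form P x 0 = 0"
  by (simp add: form_def)

lemma form_add_right: "form P x (y + z) = form P x y + form P x z"
  by (simp add: form_def distrib_left sum.distrib)

lemma form_sum_right: "form P x (sum f A) = (\<Sum>a\<in>A. form P x (f a))"
  by (induction A rule: infinite_finite_induct) (simp_all add: form_0_right form_add_right)

text \<open>Serves twice: \<open>form P w w\<close> is self-conjugate, hence real, and orthogonality
  is a symmetric relation.\<close>

lemma form_commute:
  assumes "adj P = P"
  shows "cj (form P x y) = form P y x"
proof -
  have P: "cj (P $ i $ j) = P $ j $ i" for i j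
    using assms by (simp add: adj_def vec_eq_iff)
  show ?thesis
    unfolding form_def cj_sum cj_mult cj_cj P by (subst sum.swap) (simp add: mult_ac)
qed

lemma continuous_on_form [continuous_intros]:
  assumes "continuous_on S p" "continuous_on S f" "continuous_on S g"
  shows "continuous_on S (\<lambda>x. form (p x) (f x) (g x))"
  unfolding form_def using assms by (intro continuous_intros)

lemma continuous_on_vector_scale [continuous_intros]:
  fixes g :: "_ \<Rightarrow> 'f ^ 'n"
  shows "continuous_on S f \<Longrightarrow> continuous_on S g \<Longrightarrow> continuous_on S (\<lambda>x. f x *s g x)"
  unfolding vector_scalar_mult_def by (intro continuous_intros)

section \<open>Gram-Schmidt, continuous in the matrix\<close>

text \<open>\<open>form P w w\<close> is a positive real \<open>r\<close>, and \<open>cj\<close>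
  fixes the real factor \<open>c\<close>, so the two slots together divide \<open>r\<close> by
  \<open>sqrt r\<close> twice.\<close>

lemma normalize_form:
  assumes "P \<in> pos_def" "w \<noteq> 0"
  defines "c \<equiv> of_real (1 / sqrt (rpart (form P w w)))"
  shows "form P (c *s w) (c *s w) = 1"
proof -
  define r where "r = rpart (form P w w)"
  have r: "r > 0"
    using assms by (simp add: pos_def_def r_def)
  have "form P w w = of_real r"
    using assms form_commute[of P w w] self_conj_real by (simp add: pos_def_def r_def)
  moreover have "c = of_real (1 / sqrt r)"
    by (simp add: c_def r_def)
  ultimately have "form P (c *s w) (c *s w) = of_real (1 / sqrt r * (1 / sqrt r * r))"
    by (simp only: form_scale_left form_scale_right cj_of_real of_real_mult)
  also have "1 / sqrt r * (1 / sqrt r * r) = 1"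
    using r by (simp add: field_simps)
  finally show ?thesis
    by simp
qed

text \<open>
  The support condition makes the unnormalised new vector non-zero: its \<open>k\<close>-th entry is 1.
\<close>

lemma gram_schmidt:
  fixes I :: "'n::finite set"
  shows "\<exists>e :: 'n \<Rightarrow> 'f ^ 'n ^ 'n \<Rightarrow> 'f ^ 'n. (\<forall>i\<in>I. continuous_on pos_def (e i)) \<and>
    (\<forall>P\<in>pos_def. \<forall>i\<in>I. (\<forall>j\<in>I. form P (e i P) (e j P) = (if i = j then 1 else 0)) \<and>
      (\<forall>k. k \<notin> I \<longrightarrow> e i P $ k = 0))"
  using finite[of I]
\<comment> \<open>Induction on the index set replaces an ordering of the coordinates. Each
  \<open>e i\<close> is a function of \<open>P\<close>, so that continuity in \<open>P\<close> can
  be carried along.\<close>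
proof (induction I)
  case empty
  show ?case by simp
next
  case (insert k I)
  then obtain e :: "'n \<Rightarrow> 'f ^ 'n ^ 'n \<Rightarrow> 'f ^ 'n" where
    cont: "\<And>i. i \<in> I \<Longrightarrow> continuous_on pos_def (e i)" and
    orth: "\<And>P i j. P \<in> pos_def \<Longrightarrow> i \<in> I \<Longrightarrow> j \<in> I \<Longrightarrow>
      form P (e i P) (e j P) = (if i = j then 1 else 0)" and
    supp: "\<And>P i j. P \<in> pos_def \<Longrightarrow> i \<in> I \<Longrightarrow> j \<notin> I \<Longrightarrow> e i P $ j = 0"
    by blast
  \<comment> \<open>The standard basis vector at \<open>k\<close> minus its
    \<open>P\<close>-orthogonal projection onto the span of the earlier vectors.\<close>
  define w where
    "w P = axis k 1 - (\<Sum>i\<in>I. form P (e i P) (axis k 1) *s e i P)" for P :: "'f ^ 'n ^ 'n"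
  define u where "u P = of_real (1 / sqrt (rpart (form P (w P) (w P)))) *s w P" for P
  have wk: "w P $ k = 1" if "P \<in> pos_def" for P
    using that supp insert.hyps(2) by (simp add: w_def axis_def)
  then have w0: "w P \<noteq> 0" if "P \<in> pos_def" for P
    using that by (metis zero_index zero_neq_one)
  have w_supp: "w P $ j = 0" if "P \<in> pos_def" "j \<notin> insert k I" for P j
    using that supp by (simp add: w_def axis_def)
  have w_orth: "form P (e i P) (w P) = 0" if P: "P \<in> pos_def" and i: "i \<in> I" for P i
  proof -
    \<comment> \<open>Orthonormality leaves only the summand at \<open>i\<close>, which cancels
      \<open>form P (e i P) (axis k 1)\<close>.\<close>
    have "(\<Sum>j\<in>I. form P (e j P) (axis k 1) * form P (e i P) (e j P)) =
        (\<Sum>j\<in>I. if i = j then form P (e j P) (axis k 1) else 0)"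
      by (rule sum.cong) (auto simp: orth P i)
    then show ?thesis
      using i insert.hyps(1) by (simp add: w_def form_diff_right form_sum_right form_scale_right)
  qed
  have cont_w: "continuous_on pos_def w"
    unfolding w_def by (intro continuous_intros cont)
  \<comment> \<open>The normalising factor has no pole on \<open>pos_def\<close>, hence is
    continuous there.\<close>
  have "rpart (form P (w P) (w P)) \<noteq> 0" if "P \<in> pos_def" for P
    using w0[OF that] that by (force simp: pos_def_def)
  then have cont_u: "continuous_on pos_def u"
    unfolding u_def by (intro continuous_intros cont_w) auto
  have uu: "form P (u P) (u P) = 1" if "P \<in> pos_def" for P
    unfolding u_def using that w0 by (intro normalize_form)
  have eu: "form P (e i P) (u P) = 0" if "P \<in> pos_def" "i \<in> I" for P i
    using that w_orth by (simp add: u_def form_scale_right)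
  have ue: "form P (u P) (e i P) = 0" if "P \<in> pos_def" "i \<in> I" for P i
    using form_commute[of P "e i P" "u P"] eu[OF that] that by (simp add: pos_def_def cj_0)
  have u_supp: "u P $ j = 0" if "P \<in> pos_def" "j \<notin> insert k I" for P j
    using w_supp[OF that] by (simp add: u_def)
  show ?case
    using insert.hyps(2) cont orth supp cont_u uu eu ue u_supp
    by (intro exI[of _ "e(k := u)"]) auto
qed

lemma continuous_orthonormalisation:
  obtains T :: "'f ^ 'n ^ 'n \<Rightarrow> 'f ^ 'n ^ 'n::finite"
  where "continuous_on pos_def T"
    and "\<And>P. P \<in> pos_def \<Longrightarrow> adj (T P) ** P ** T P = mat 1"
proof -
  obtain e :: "'n \<Rightarrow> 'f ^ 'n ^ 'n \<Rightarrow> 'f ^ 'n" where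
    cont: "\<And>i. continuous_on pos_def (e i)" and
    orth: "\<And>P i j. P \<in> pos_def \<Longrightarrow> form P (e i P) (e j P) = (if i = j then 1 else 0)"
    using gram_schmidt[of "UNIV :: 'n set"] by blast
  \<comment> \<open>This index order makes \<open>e j P\<close> the \<open>j\<close>-th
    column.\<close>
  define T where "T P = (\<chi> i j. e j P $ i)" for P
  have col: "column i (T P) = e i P" for i P
    by (simp add: T_def column_def vec_eq_iff)
  show ?thesis
  proof
    show "continuous_on pos_def T"
      unfolding T_def by (intro continuous_intros cont)
    show "adj (T P) ** P ** T P = mat 1" if "P \<in> pos_def" for P
      using orth[OF that] by (simp add: vec_eq_iff form_columns col mat_def)
  qed
qed

end

section \<open>Inner products, Gram matrices and the right action of matrices\<close>

locale inner_product_over = involutive_scalars cj rpart + vector_space smul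
  for cj :: "'f::real_normed_field \<Rightarrow> 'f"
    and rpart :: "'f \<Rightarrow> real"
    and smul :: "'f \<Rightarrow> 'h::real_normed_vector \<Rightarrow> 'h" +
  fixes ip :: "'h \<Rightarrow> 'h \<Rightarrow> 'f"
  assumes ip_commute: "ip x y = cj (ip y x)"
    and ip_add_left: "ip (x + y) z = ip x z + ip y z"
    and ip_smul_left: "ip (smul c x) y = cj c * ip x y"
    and ip_pos: "x \<noteq> 0 \<Longrightarrow> 0 < rpart (ip x x)"
    and continuous_smul: "continuous_on UNIV (\<lambda>(c, x). smul c x)"
    and continuous_ip: "continuous_on UNIV (\<lambda>(x, y). ip x y)"
begin

lemma continuous_on_smul [continuous_intros]:
  assumes "continuous_on S f" "continuous_on S g"
  shows "continuous_on S (\<lambda>x. smul (f x) (g x))"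
  using continuous_on_compose2[OF continuous_smul continuous_on_Pair[OF assms]] by simp

lemma continuous_on_ip [continuous_intros]:
  assumes "continuous_on S f" "continuous_on S g"
  shows "continuous_on S (\<lambda>x. ip (f x) (g x))"
  using continuous_on_compose2[OF continuous_ip continuous_on_Pair[OF assms]] by simp

lemma ip_0_left: "ip 0 y = 0"
  using ip_smul_left[of 0 0 y] by (simp add: cj_0)

lemma ip_sum_left: "ip (sum f A) y = (\<Sum>a\<in>A. ip (f a) y)"
  by (induction A rule: infinite_finite_induct) (simp_all add: ip_0_left ip_add_left)

lemma ip_sum_right: "ip x (sum f A) = (\<Sum>a\<in>A. ip x (f a))"
  using ip_commute[of x "sum f A"] ip_commute[of x]
  by (simp add: ip_sum_left cj_sum)

lemma ip_smul_right: "ip x (smul c y) = c * ip x y"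
  using ip_commute[of x "smul c y"] ip_commute[of x y] by (simp add: ip_smul_left cj_mult cj_cj)

definition gram :: "'h ^ 'n \<Rightarrow> 'f ^ 'n ^ 'n" where
  "gram v = (\<chi> i j. ip (v $ i) (v $ j))"

definition act :: "'h ^ 'n \<Rightarrow> 'f ^ 'm ^ 'n \<Rightarrow> 'h ^ 'm" where
  "act v A = (\<chi> j. \<Sum>i\<in>UNIV. smul (A $ i $ j) (v $ i))"

lemma continuous_on_gram [continuous_intros]:
  "continuous_on S f \<Longrightarrow> continuous_on S (\<lambda>x. gram (f x))"
  unfolding gram_def by (intro continuous_intros)

lemma continuous_on_act [continuous_intros]:
  "continuous_on S f \<Longrightarrow> continuous_on S g \<Longrightarrow> continuous_on S (\<lambda>x. act (f x) (g x))"
  unfolding act_def by (intro continuous_intros)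

lemma act_mat_1: "act v (mat 1) = v"
proof -
  have "(\<Sum>i\<in>UNIV. smul (mat 1 $ i $ j) (v $ i)) = (\<Sum>i\<in>UNIV. if i = j then v $ i else 0)"
    for j
    by (rule sum.cong) (auto simp: mat_def)
  then show ?thesis
    by (simp add: act_def vec_eq_iff)
qed

lemma act_act: "act (act v A) B = act v (A ** B)"
proof -
  have "(\<Sum>i\<in>UNIV. smul (B $ i $ j) (\<Sum>k\<in>UNIV. smul (A $ k $ i) (v $ k))) =
      (\<Sum>k\<in>UNIV. smul (\<Sum>i\<in>UNIV. A $ k $ i * B $ i $ j) (v $ k))" for j
    unfolding scale_sum_right scale_sum_left by (subst sum.swap) (simp add: mult.commute)
  then show ?thesis
    by (simp add: act_def matrix_matrix_mult_def vec_eq_iff)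
qed

text \<open>The bridge from the space to matrices: \<open>form (gram v)\<close> is the inner product
  pulled back along the map sending coefficients to linear combinations of \<open>v\<close>.\<close>

lemma ip_combinations:
  "ip (\<Sum>i\<in>UNIV. smul (x $ i) (v $ i)) (\<Sum>i\<in>UNIV. smul (y $ i) (v $ i)) = form (gram v) x y"
  unfolding ip_sum_left
  by (simp add: ip_sum_right form_def gram_def ip_smul_left ip_smul_right mult_ac)

text \<open>The entries of \<open>act v A\<close> are the combinations of \<open>v\<close> with the
  columns of \<open>A\<close> as coefficients, so \<open>ip_combinations\<close> and
  \<open>form_columns\<close> meet entrywise.\<close>

lemma gram_act: "gram (act v A) = adj A ** gram v ** A"
  unfolding vec_eq_iff form_columns
  by (simp add: gram_def[of "act v A"] column_def flip: ip_combinations) (simp add: act_def)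

lemma orth_stiefel_iff_gram: "v \<in> orth_stiefel ip \<longleftrightarrow> gram v = mat 1"
  by (simp add: orth_stiefel_def gram_def mat_def vec_eq_iff)

section \<open>Linear independence through the Gram matrix\<close>

text \<open>Injectivity lets relations indexed by the set of entries and relations indexed by
  coordinates be reindexed into each other.\<close>

lemma stiefel_iff:
  fixes v :: "'h ^ 'n"
  shows "v \<in> stiefel smul \<longleftrightarrow> (\<forall>x :: 'f ^ 'n. (\<Sum>i\<in>UNIV. smul (x $ i) (v $ i)) = 0 \<longrightarrow> x = 0)"
proof
  assume "v \<in> stiefel smul"
  then have inj: "inj (($) v)" and indep: "independent (range (($) v))"
    by (simp_all add: stiefel_def)
  show "\<forall>x :: 'f ^ 'n. (\<Sum>i\<in>UNIV. smul (x $ i) (v $ i)) = 0 \<longrightarrow> x = 0"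
  proof (intro allI impI)
    fix x :: "'f ^ 'n"
    assume x: "(\<Sum>i\<in>UNIV. smul (x $ i) (v $ i)) = 0"
    \<comment> \<open>Each vector receives the coefficient of its unique index.\<close>
    have "(\<Sum>h\<in>range (($) v). smul (x $ inv (($) v) h) h) = 0"
      using x inj by (simp add: sum.reindex)
    then have "\<forall>h\<in>range (($) v). x $ inv (($) v) h = 0"
      using indep by (subst (asm) dependent_finite) auto
    then show "x = 0"
      using inj by (simp add: vec_eq_iff)
  qed
next
  assume R: "\<forall>x :: 'f ^ 'n. (\<Sum>i\<in>UNIV. smul (x $ i) (v $ i)) = 0 \<longrightarrow> x = 0"
  have inj: "inj (($) v)"
  proof (rule injI, rule ccontr)
    fix i j assume ij: "v $ i = v $ j" "i \<noteq> j"
    \<comment> \<open>A repeated entry yields this non-trivial relation.\<close>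
    let ?x = "axis i 1 - axis j 1 :: 'f ^ 'n"
    have "(\<Sum>k\<in>UNIV. smul (?x $ k) (v $ k)) =
        (\<Sum>k\<in>UNIV. (if k = i then v $ k else 0) - (if k = j then v $ k else 0))"
      by (rule sum.cong) (auto simp: axis_def scale_left_diff_distrib)
    also have "\<dots> = 0"
      using ij by (simp add: sum_subtractf)
    finally have "?x $ i = 0"
      using R by (metis zero_index)
    then show False
      using ij by (simp add: axis_def)
  qed
  have "u (v $ i) = 0" if "(\<Sum>h\<in>range (($) v). smul (u h) h) = 0" for u i
  proof -
    have "(\<Sum>i\<in>UNIV. smul ((\<chi> i. u (v $ i)) $ i) (v $ i)) = 0"
      using that inj by (simp add: sum.reindex)
    then have "(\<chi> i. u (v $ i)) = (0 :: 'f ^ 'n)"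
      using R by blast
    then show ?thesis
      by (simp add: vec_eq_iff)
  qed
  then have "independent (range (($) v))"
    by (subst dependent_finite) auto
  with inj show "v \<in> stiefel smul"
    by (simp add: stiefel_def)
qed

text \<open>The quadratic form of \<open>gram v\<close> at \<open>x\<close> is the inner product of
  the combination of \<open>v\<close> with itself, positive exactly when that combination is
  non-zero.\<close>

lemma stiefel_iff_gram: "v \<in> stiefel smul \<longleftrightarrow> gram v \<in> pos_def"
proof -
  \<comment> \<open>Rules out positivity at the zero vector.\<close>
  have "rpart 0 = 0"
    using self_conj_real[OF cj_0] by simp
  then have "0 < rpart (ip h h) \<longleftrightarrow> h \<noteq> 0" for h
    using ip_pos[of h] by (auto simp: ip_0_left)
  moreover have "adj (gram v) = gram v"
    by (simp add: adj_def gram_def vec_eq_iff flip: ip_commute)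
  ultimately show ?thesis
    unfolding stiefel_iff by (auto simp: pos_def_def simp flip: ip_combinations)
qed

section \<open>The homeomorphism over general scalars\<close>

theorem stiefel_homeomorphic:
  "(stiefel smul :: ('h ^ 'n::finite) set) homeomorphic
    (orth_stiefel ip :: ('h ^ 'n) set) \<times> (pos_def :: ('f ^ 'n ^ 'n) set)"
proof -
  obtain T :: "'f ^ 'n ^ 'n \<Rightarrow> 'f ^ 'n ^ 'n" where
    cont: "continuous_on pos_def T" and
    T: "\<And>P. P \<in> pos_def \<Longrightarrow> adj (T P) ** P ** T P = mat 1"
    using continuous_orthonormalisation by blast
  \<comment> \<open>For square matrices a left inverse is also a right inverse.\<close>
  have T': "T P ** (adj (T P) ** P) = mat 1" if "P \<in> pos_def" for P
    using T[OF that] matrix_left_right_inverse by blast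
  \<comment> \<open>With \<open>gram u = mat 1\<close> and \<open>adj P = P\<close>,
    \<open>gram_act\<close> gives \<open>P ** T P ** adj (T P) ** P\<close>, and \<open>T'\<close>
    collapses the last three factors.\<close>
  have gram: "gram (act u (adj (T P) ** P)) = P" if "gram u = mat 1" "P \<in> pos_def" for u P
  proof -
    have "gram (act u (adj (T P) ** P)) = P ** (T P ** (adj (T P) ** P))"
      using that by (simp add: gram_act adj_mult adj_adj pos_def_def matrix_mul_assoc)
    then show ?thesis
      using T' that by simp
  qed
  \<comment> \<open>\<open>T\<close> is known to be continuous only on \<open>pos_def\<close>, so
    the inner function must stay there.\<close>
  have cont_T: "continuous_on S (\<lambda>x. T (f x))"
    if "continuous_on S f" "\<And>x. x \<in> S \<Longrightarrow> f x \<in> pos_def" for S :: "'s::topological_space set" and f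
    using continuous_on_compose2[OF cont that(1)] that(2) by blast
  let ?f = "\<lambda>v. (act v (T (gram v)), gram v)"
  let ?g = "\<lambda>(u, P). act u (adj (T P) ** P)"
  have "homeomorphism (stiefel smul) (orth_stiefel ip \<times> pos_def) ?f ?g"
  proof (rule homeomorphismI)
    show "continuous_on (stiefel smul) ?f"
      by (intro continuous_intros cont_T) (simp add: stiefel_iff_gram)
    show "continuous_on (orth_stiefel ip \<times> pos_def) ?g"
      unfolding case_prod_beta by (intro continuous_intros cont_T) auto
    show "?f ` stiefel smul \<subseteq> orth_stiefel ip \<times> pos_def"
      using T by (auto simp: stiefel_iff_gram orth_stiefel_iff_gram gram_act)
    show "?g ` (orth_stiefel ip \<times> pos_def) \<subseteq> stiefel smul"
      using gram by (auto simp: stiefel_iff_gram orth_stiefel_iff_gram)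
    show "?g (?f v) = v" if "v \<in> stiefel smul" for v
      using that T' by (simp add: stiefel_iff_gram act_act act_mat_1)
    \<comment> \<open>By \<open>gram\<close>, the Gram matrix of the image is the original
      \<open>P\<close>, so \<open>T\<close> is evaluated at \<open>P\<close> again and cancels
      \<open>adj (T P) ** P\<close>.\<close>
    show "?f (?g y) = y" if "y \<in> orth_stiefel ip \<times> pos_def" for y
      using that T gram by (auto simp: orth_stiefel_iff_gram act_act act_mat_1)
  qed
  then show ?thesis
    unfolding homeomorphic_def by blast
qed

end

section \<open>The real case\<close>

interpretation real_stiefel: inner_product_over
  "\<lambda>x. x" "\<lambda>x. x" scaleR "inner :: 'a::real_inner \<Rightarrow> 'a \<Rightarrow> real"
proof unfold_locales
  show "continuous_on UNIV (\<lambda>(c, x :: 'a). c *\<^sub>R x)"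
    unfolding case_prod_beta by (intro continuous_intros)
  show "continuous_on UNIV (\<lambda>(x :: 'a, y). x \<bullet> y)"
    unfolding case_prod_beta by (intro continuous_intros)
qed (auto simp: inner_commute inner_add algebra_simps)

lemma pos_def_real_eq: "pos_def_real = real_stiefel.pos_def"
  unfolding pos_def_real_def real_stiefel.pos_def_def real_stiefel.form_conv_matrix_vector_mult
    real_stiefel.adj_def transpose_def inner_vec_def by simp

section \<open>The complex case\<close>

lemma cinner_add_right: "cinner x (y + z) = cinner x y + cinner x z"
  by (metis cinner_add_left cinner_commute complex_cnj_add)

lemma cinner_scaleC_right: "cinner x (c *\<^sub>C y) = c * cinner x y"
  by (metis cinner_commute cinner_scaleC_left complex_cnj_cnj complex_cnj_mult)

lemma norm_scaleC_ii: "norm (\<i> *\<^sub>C x) = norm (x :: 'a::complex_inner)"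
  by (simp add: norm_eq_sqrt_cinner cinner_scaleC_left cinner_scaleC_right flip: mult.assoc)

lemma continuous_on_scaleC_ii:
  "continuous_on S f \<Longrightarrow> continuous_on S (\<lambda>x. \<i> *\<^sub>C (f x :: 'a::complex_inner))"
proof -
  have "bounded_linear (\<lambda>x :: 'a. \<i> *\<^sub>C x)"
    by (rule bounded_linear_intro[where K = 1])
      (simp_all add: scaleC_add_right scaleR_scaleC scaleC_scaleC mult.commute norm_scaleC_ii)
  then show "continuous_on S f \<Longrightarrow> continuous_on S (\<lambda>x. \<i> *\<^sub>C f x)"
    by (rule bounded_linear.continuous_on)
qed

text \<open>Reduces joint continuity of complex scaling to real scaling and the isometry given by
  \<open>\<i>\<close>.\<close>

lemma scaleC_conv_Re_Im: "c *\<^sub>C x = Re c *\<^sub>R x + Im c *\<^sub>R (\<i> *\<^sub>C x)"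
proof -
  have "c *\<^sub>C x = (of_real (Re c) + of_real (Im c) * \<i>) *\<^sub>C x"
    by (rule arg_cong[of c]) (simp add: complex_eq_iff)
  then show ?thesis
    by (simp only: scaleR_scaleC scaleC_scaleC scaleC_add_left)
qed

lemma cinner_self: "cinner x x = of_real ((norm x)\<^sup>2)"
proof -
  have "Im (cinner x x) = 0"
    using arg_cong[OF cinner_commute[of x x], of Im] by simp
  then show ?thesis
    by (simp add: complex_eq_iff norm_eq_sqrt_cinner cinner_ge_zero)
qed

text \<open>Polarisation: continuity of the inner product is drawn from that of the norm, without a
  Cauchy-Schwarz estimate.\<close>

lemma Re_cinner_polar: "Re (cinner x y) = ((norm (x + y))\<^sup>2 - (norm x)\<^sup>2 - (norm y)\<^sup>2) / 2"
proof -
  have "Re (cinner y x) = Re (cinner x y)"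
    by (subst cinner_commute) simp
  moreover have "(norm z)\<^sup>2 = Re (cinner z z)" for z :: 'a
    by (simp add: cinner_self)
  ultimately show ?thesis
    by (simp add: cinner_add_left cinner_add_right)
qed

text \<open>Conjugate-linearity turns \<open>\<i>\<close> in the first slot into the factor
  \<open>-\<i>\<close>, which moves the imaginary part to the real part, where polarisation
  applies.\<close>

lemma cinner_conv_Re:
  "cinner x y = of_real (Re (cinner x y)) + \<i> * of_real (Re (cinner (\<i> *\<^sub>C x) y))"
  by (simp add: complex_eq_iff cinner_scaleC_left)

interpretation complex_stiefel: inner_product_over
  cnj Re scaleC "cinner :: 'a::complex_inner \<Rightarrow> 'a \<Rightarrow> complex"
proof unfold_locales
  show "continuous_on UNIV (\<lambda>(c, x :: 'a). c *\<^sub>C x)"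
    unfolding case_prod_beta
    by (subst scaleC_conv_Re_Im) (intro continuous_intros continuous_on_scaleC_ii)
  show "continuous_on UNIV (\<lambda>(x :: 'a, y). cinner x y)"
    unfolding case_prod_beta
    by (subst cinner_conv_Re, unfold Re_cinner_polar)
      (intro continuous_intros continuous_on_scaleC_ii; simp)
  show "of_real (Re a) = a" if "cnj a = a" for a
    using that by (simp add: complex_eq_iff)
  show "cinner x y = cnj (cinner y x)" for x y :: 'a
    by (rule cinner_commute)
  show "0 < Re (cinner x x)" if "x \<noteq> 0" for x :: 'a
    using that by (simp add: cinner_self)
qed (simp_all add: cinner_add_left cinner_scaleC_left continuous_on_cnj continuous_on_Re)

lemma pos_def_complex_eq: "pos_def_complex = complex_stiefel.pos_def"
  unfolding pos_def_complex_def complex_stiefel.pos_def_def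
    complex_stiefel.form_conv_matrix_vector_mult complex_stiefel.adj_def conj_transpose_def
  by simp

theorem theorem3p1:
  "(dim_at_least (scaleR :: real \<Rightarrow> 'a \<Rightarrow> 'a::{real_inner, complete_space}) CARD('n::finite) \<longrightarrow>
      (stiefel (scaleR :: real \<Rightarrow> 'a \<Rightarrow> 'a) :: ('a ^ 'n) set) homeomorphic
      (orth_stiefel (inner :: 'a \<Rightarrow> 'a \<Rightarrow> real) :: ('a ^ 'n) set) \<times>
      (pos_def_real :: (real ^ 'n ^ 'n) set))
   \<and>
   (dim_at_least (scaleC :: complex \<Rightarrow> 'b \<Rightarrow> 'b::complex_hilbert) CARD('n) \<longrightarrow>
      (stiefel (scaleC :: complex \<Rightarrow> 'b \<Rightarrow> 'b) :: ('b ^ 'n) set) homeomorphic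
      (orth_stiefel (cinner :: 'b \<Rightarrow> 'b \<Rightarrow> complex) :: ('b ^ 'n) set) \<times>
      (pos_def_complex :: (complex ^ 'n ^ 'n) set))"
  unfolding pos_def_real_eq pos_def_complex_eq
  using real_stiefel.stiefel_homeomorphic complex_stiefel.stiefel_homeomorphic by blast

end
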